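(* The bivariate generating function $G(u,z)=\sum_{n=2}^{\infty}\sum_{\mathcal{C}\in \mathrm{IC}(C_n)} u^{\mathrm{mix}(\mathcal{C})}z^n$ for integrated colorings of cycles, counted according to the order $n$ of the cycle (variable $z$) and the mixing number of the coloring (variable $u$), is \[G(u,z)=\frac{2u^2z^2+6u^2z^3+4u^2z^4}{1-u^2z^2-2u^2z^3-u^2z^4}.\]
   Context: Let $G=(V,E)$ be a finite labeled graph (or multigraph). A coloring of $G$ is an arbitrary map $\mathcal{C}: V \to \{\text{black},\text{white}\}$. An edge is balanced if its endpoints have different colors. The mixing number $\mathrm{mix}(\mathcal{C})$ is the number of balanced edges of $G$. For a vertex $v$, $\mathrm{mix}(v)$ is the number of balanced edges incident to $v$. A vertex $v$ is integrated if $\mathrm{mix}(v)\geq \frac12\deg(v)$, and $\mathcal{C}$ is integrated if every vertex is integrated. $\mathrm{IC}(G)$ is the set of integrated colorings of $G$. The cycle $C_n$ ($n\ge 2$) has labeled vertices $1,\dots,n$ with $i$ joined to $i+1$ modulo $n$; $C_2$ is the multigraph of two vertices joined by two parallel edges. The identity is one of formal power series in $z$ with coefficients in $\mathbb{Z}[u]$. *)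

theory Defs
  imports
    Complex_Main
    "HOL-Library.FuncSet"
    "HOL-Library.Multiset"
    "HOL-Computational_Algebra.Polynomial"
    "HOL-Computational_Algebra.Formal_Power_Series"
begin

text \<open>
  Edges carry an identity of their own, so that parallel edges are counted separately;
  the two endpoints of an edge form a multiset of size 2 (a loop repeats its vertex).
\<close>

record ('v, 'e) multigraph =
  verts :: "'v set"
  edges :: "'e set"
  ends :: "'e \<Rightarrow> 'v multiset"

locale fin_multigraph =
  fixes G :: "('v, 'e) multigraph"
  assumes finite_verts: "finite (verts G)"
    and finite_edges: "finite (edges G)"
    and size_ends: "e \<in> edges G \<Longrightarrow> size (ends G e) = 2"
    and ends_in_verts: "e \<in> edges G \<Longrightarrow> set_mset (ends G e) \<subseteq> verts G"

definition degree :: "('v, 'e) multigraph \<Rightarrow> 'v \<Rightarrow> nat" where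
  "degree G v = (\<Sum>e\<in>edges G. count (ends G e) v)"

datatype color = Black | White

text \<open>
  Colorings are taken to be extensional outside the vertex set, so that each map from the
  vertices to the colors is represented by exactly one HOL function.
\<close>

definition colorings :: "('v, 'e) multigraph \<Rightarrow> ('v \<Rightarrow> color) set" where
  "colorings G = (verts G \<rightarrow>\<^sub>E UNIV)"

definition balanced :: "('v, 'e) multigraph \<Rightarrow> ('v \<Rightarrow> color) \<Rightarrow> 'e \<Rightarrow> bool" where
  "balanced G c e \<longleftrightarrow> (\<exists>x y. ends G e = {#x, y#} \<and> c x \<noteq> c y)"

definition mix :: "('v, 'e) multigraph \<Rightarrow> ('v \<Rightarrow> color) \<Rightarrow> nat" where
  "mix G c = card {e \<in> edges G. balanced G c e}"

definition mix_at :: "('v, 'e) multigraph \<Rightarrow> ('v \<Rightarrow> color) \<Rightarrow> 'v \<Rightarrow> nat" where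
  "mix_at G c v = card {e \<in> edges G. v \<in># ends G e \<and> balanced G c e}"

definition integrated_at :: "('v, 'e) multigraph \<Rightarrow> ('v \<Rightarrow> color) \<Rightarrow> 'v \<Rightarrow> bool" where
  "integrated_at G c v \<longleftrightarrow> real (mix_at G c v) \<ge> 1 / 2 * real (degree G v)"

definition integrated :: "('v, 'e) multigraph \<Rightarrow> ('v \<Rightarrow> color) \<Rightarrow> bool" where
  "integrated G c \<longleftrightarrow> (\<forall>v\<in>verts G. integrated_at G c v)"

definition IC :: "('v, 'e) multigraph \<Rightarrow> ('v \<Rightarrow> color) set" where
  "IC G = {c \<in> colorings G. integrated G c}"

text \<open>
  Edge \<open>i\<close> of the cycle joins \<open>i\<close> to its cyclic successor. For \<open>n = 2\<close> the edges 1 and 2 are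
  parallel. Only \<open>n \<ge> 2\<close> is meaningful.
\<close>

definition cycle :: "nat \<Rightarrow> (nat, nat) multigraph" where
  "cycle n = \<lparr>verts = {1..n}, edges = {1..n}, ends = (\<lambda>i. {#i, i mod n + 1#})\<rparr>"

lemma fin_multigraph_cycle: "fin_multigraph (cycle n)"
  by unfold_locales (auto simp: cycle_def Suc_le_eq)

text \<open>
  The ring of formal power series in \<open>z\<close> over the polynomials in \<open>u\<close> with integer coefficients.
\<close>

abbreviation var_u :: "int poly fps" where
  "var_u \<equiv> fps_const [:0, 1:]"

abbreviation var_z :: "int poly fps" where
  "var_z \<equiv> fps_X"

definition integrated_cycles_gf :: "int poly fps" where
  "integrated_cycles_gf =
     Abs_fps (\<lambda>n. if n \<ge> 2 then \<Sum>c\<in>IC (cycle n). [:0, 1:] ^ mix (cycle n) c else 0)"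

text \<open>
  The division of formal power series in the library needs an inverse operation on the
  coefficients, which \<^typ>\<open>int poly\<close> does not have. For a denominator with constant
  coefficient 1, the quotient is the numerator times the reciprocal power series.
\<close>

definition fps_quot :: "'a::comm_ring_1 fps \<Rightarrow> 'a fps \<Rightarrow> 'a fps" where
  "fps_quot f g = f * fps_right_inverse g 1"

lemma fps_quot_eq_iff:
  assumes "fps_nth g 0 = 1"
  shows "fps_quot f g = h \<longleftrightarrow> f = h * g"
proof -
  have inv: "g * fps_right_inverse g 1 = 1"
    by (rule fps_right_inverse) (simp add: assms)
  show ?thesis
  proof
    assume h: "fps_quot f g = h"
    have "h * g = f * (g * fps_right_inverse g 1)"
      unfolding h[symmetric] by (simp only: fps_quot_def mult_ac)
    then show "f = h * g" by (simp only: inv mult_1_right)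
  next
    assume "f = h * g"
    then have "fps_quot f g = h * (g * fps_right_inverse g 1)"
      by (simp only: fps_quot_def mult_ac)
    then show "fps_quot f g = h" by (simp only: inv mult_1_right)
  qed
qed

end

theory Submission
  imports Defs
begin

text \<open>
  Every vertex of a cycle has degree 2, so a coloring is integrated iff every vertex lies on a
  balanced edge, that is, iff no three cyclically consecutive vertices have the same color.
  Both this condition and the mixing number are local: \<open>u ^ mix c\<close>, set to 0 for colorings that
  are not integrated, is a product over all windows of three cyclically consecutive colors
  (\<open>integrated_weight_eq_prod\<close>). A window contributes 0 if it is monochromatic, and otherwise
  \<open>u\<close> or 1 according to whether its first edge is balanced.

  The sum over all colorings can therefore be computed by a transfer matrix whose states are
  pairs of consecutive colors. Cutting the cycle open at its first two vertices turns it into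
  a sum of \<open>bridge_sum\<close>s: weighted sums over the color words that lead from one pair to another.

  The recurrence for these sums comes from the monochromatic blocks of a word. Windows of positive
  weight allow only blocks of length 1 or 2, and every passage to the next block costs a factor
  \<open>u\<close>, so that a block contributes \<open>u z + u z\<^sup>2\<close>. Removing one block exchanges the
  two colors at the start of the word; removing two restores them. Hence the sums satisfy the recurrence with
  characteristic power series \<open>1 - (u z + u z\<^sup>2)\<^sup>2 = 1 - u\<^sup>2 z\<^sup>2 - 2 u\<^sup>2 z\<^sup>3 - u\<^sup>2 z\<^sup>4\<close>,
  which is the denominator of the theorem (\<open>bridge_sum_recurrence\<close>). The numerator is the defect
  of the recurrence at orders 2, 3 and 4, where it would refer to cycles of order less than 2,
  whose coefficients are 0 in the generating function.
\<close>

section \<open>Integrated colorings of cycles by windows of three vertices\<close>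

lemma cycle_simps [simp]:
  "verts (cycle n) = {1..n}" "edges (cycle n) = {1..n}" "ends (cycle n) i = {#i, i mod n + 1#}"
  by (simp_all add: cycle_def)

lemma balanced_cycle_iff: "balanced (cycle n) c i \<longleftrightarrow> c i \<noteq> c (i mod n + 1)"
  by (auto simp: balanced_def add_eq_conv_diff split: if_splits)

lemma bij_betw_cyclic_succ: "bij_betw (\<lambda>i. i mod n + 1) {1..n} {1..n::nat}"
proof -
  have "inj_on (\<lambda>i. i mod n + 1) {1..n}"
  proof (rule inj_onI)
    fix i j assume "i \<in> {1..n}" "j \<in> {1..n}" "i mod n + 1 = j mod n + 1"
    then show "i = j"
      by (cases "i = n"; cases "j = n") auto
  qed
  moreover have "(\<lambda>i. i mod n + 1) ` {1..n} \<subseteq> {1..n}"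
    by (auto simp: Suc_le_eq)
  ultimately show ?thesis
    by (simp add: bij_betw_def endo_inj_surj)
qed

lemma degree_cycle:
  assumes "v \<in> {1..n}"
  shows "degree (cycle n) v = 2"
proof -
  have "degree (cycle n) v =
      (\<Sum>i\<in>{1..n}. if i = v then 1 else 0) + (\<Sum>i\<in>{1..n}. if i mod n + 1 = v then 1 else 0)"
    unfolding degree_def sum.distrib[symmetric] by (rule sum.cong) auto
  also have "(\<Sum>i\<in>{1..n}. if i mod n + 1 = v then 1 else 0) = (\<Sum>i\<in>{1..n}. if i = v then 1 else 0 :: nat)"
    by (rule sum.reindex_bij_betw[OF bij_betw_cyclic_succ])
  also have "(\<Sum>i\<in>{1..n}. if i = v then 1 else 0 :: nat) = 1"
    using assms by simp
  finally show ?thesis by simp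
qed

lemma integrated_at_cycle_iff:
  assumes "v \<in> {1..n}"
  shows "integrated_at (cycle n) c v \<longleftrightarrow>
    (\<exists>i\<in>{1..n}. (v = i \<or> v = i mod n + 1) \<and> c i \<noteq> c (i mod n + 1))"
proof -
  have "integrated_at (cycle n) c v \<longleftrightarrow> mix_at (cycle n) c v > 0"
    unfolding integrated_at_def degree_cycle[OF assms] by auto
  also have "\<dots> \<longleftrightarrow> (\<exists>i\<in>{1..n}. (v = i \<or> v = i mod n + 1) \<and> c i \<noteq> c (i mod n + 1))"
    unfolding mix_at_def balanced_cycle_iff by (auto simp: card_gt_0_iff)
  finally show ?thesis .
qed

text \<open>
  The condition at a vertex concerns the two edges that meet there. Indexing it by the
  predecessor \<open>i\<close> of that vertex expresses it by the window starting at \<open>i\<close>; as the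
  cyclic successor is a bijection, this reaches every vertex, also on the 2-cycle, where the
  window returns to \<open>i\<close>.
\<close>

lemma integrated_cycle_iff:
  "integrated (cycle n) c \<longleftrightarrow>
    (\<forall>i\<in>{1..n}. \<not> (c i = c (i mod n + 1) \<and> c (i mod n + 1) = c ((i mod n + 1) mod n + 1)))"
  (is "_ \<longleftrightarrow> (\<forall>i\<in>_. ?P i)")
proof -
  let ?s = "\<lambda>i. i mod n + 1"
  have "integrated (cycle n) c \<longleftrightarrow> (\<forall>v\<in>?s ` {1..n}. integrated_at (cycle n) c v)"
    using bij_betw_cyclic_succ[of n] by (simp add: integrated_def bij_betw_def)
  also have "\<dots> \<longleftrightarrow> (\<forall>i\<in>{1..n}. integrated_at (cycle n) c (?s i))"
    by simp
  also have "\<dots> \<longleftrightarrow> (\<forall>i\<in>{1..n}. ?P i)"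
  proof (rule ball_cong[OF refl])
    fix i assume i: "i \<in> {1..n}"
    have si: "?s i \<in> {1..n}"
      using bij_betwE[OF bij_betw_cyclic_succ] i by blast
    have "?s i = ?s j \<longleftrightarrow> j = i" if "j \<in> {1..n}" for j
      using inj_onD[OF bij_betw_imp_inj_on[OF bij_betw_cyclic_succ], of i n j] i that by blast
    then show "integrated_at (cycle n) c (?s i) \<longleftrightarrow> ?P i"
      unfolding integrated_at_cycle_iff[OF si] using i si by metis
  qed
  finally show ?thesis .
qed

text \<open>
  The factor \<open>u\<close> records only whether the first edge of the window is balanced. Consecutive windows
  overlap in an edge, so every edge of the cycle is counted once.
\<close>

definition window_weight :: "'a::comm_ring_1 \<Rightarrow> color \<Rightarrow> color \<Rightarrow> color \<Rightarrow> 'a" where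
  "window_weight u x y z = (if x = y \<and> y = z then 0 else if x = y then 1 else u)"

lemma integrated_weight_eq_prod:
  "(if integrated (cycle n) c then u ^ mix (cycle n) c else 0) =
    (\<Prod>i\<in>{1..n}. window_weight u (c i) (c (i mod n + 1)) (c ((i mod n + 1) mod n + 1)))"
proof (cases "integrated (cycle n) c")
  case True
  have "(\<Prod>i\<in>{1..n}. window_weight u (c i) (c (i mod n + 1)) (c ((i mod n + 1) mod n + 1))) =
      (\<Prod>i\<in>{1..n}. if c i \<noteq> c (i mod n + 1) then u else 1)"
    using True unfolding integrated_cycle_iff
    by (intro prod.cong) (auto simp: window_weight_def)
  also have "\<dots> = u ^ mix (cycle n) c"
    unfolding mix_def balanced_cycle_iff
    by (simp flip: prod.inter_filter)
  finally show ?thesis using True by simp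
next
  case False
  then obtain i where "i \<in> {1..n}"
    "c i = c (i mod n + 1) \<and> c (i mod n + 1) = c ((i mod n + 1) mod n + 1)"
    unfolding integrated_cycle_iff by blast
  then have "\<exists>i\<in>{1..n}. window_weight u (c i) (c (i mod n + 1)) (c ((i mod n + 1) mod n + 1)) = 0"
    by (intro bexI[of _ i]) (simp_all add: window_weight_def)
  then have "(\<Prod>i\<in>{1..n}. window_weight u (c i) (c (i mod n + 1)) (c ((i mod n + 1) mod n + 1))) = 0"
    by (intro prod_zero) simp_all
  then show ?thesis
    using False by simp
qed

section \<open>Color words\<close>

fun word_weight :: "'a::comm_ring_1 \<Rightarrow> color list \<Rightarrow> 'a" where
  "word_weight u (x # y # z # zs) = window_weight u x y z * word_weight u (y # z # zs)"
| "word_weight u _ = 1"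

lemma word_weight_eq_prod:
  "word_weight u xs = (\<Prod>j<length xs - 2. window_weight u (xs ! j) (xs ! (j + 1)) (xs ! (j + 2)))"
proof (induction u xs rule: word_weight.induct)
  case (1 u x y z zs)
  show ?case
    by (simp add: 1 prod.lessThan_Suc_shift del: prod.lessThan_Suc)
qed simp_all

text \<open>
  Repeating the first two letters at the end of the word of a coloring makes the windows of
  the longer word the cyclic windows of the coloring.
\<close>

lemma integrated_weight_eq_word_weight:
  assumes "n \<ge> 2" and len: "length xs = n" and c: "\<And>j. j < n \<Longrightarrow> c (Suc j) = xs ! j"
  shows "(if integrated (cycle n) c then u ^ mix (cycle n) c else 0) =
    word_weight u (xs @ take 2 xs)"
proof -
  have nth: "(xs @ take 2 xs) ! j = c (j mod n + 1)" if "j < n + 2" for j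
  proof (cases "j < n")
    case True
    then show ?thesis by (simp add: nth_append len c)
  next
    case False
    then have "j mod n = j - n" "j - n < 2"
      using that assms(1) by (simp_all add: mod_if)
    then show ?thesis
      using False assms(1) by (simp add: nth_append len c)
  qed
  have "word_weight u (xs @ take 2 xs) =
      (\<Prod>j<n. window_weight u (c (j mod n + 1)) (c ((j + 1) mod n + 1)) (c ((j + 2) mod n + 1)))"
    unfolding word_weight_eq_prod
  proof (rule prod.cong)
    show "{..<length (xs @ take 2 xs) - 2} = {..<n}"
      using assms(1) len by simp
  next
    fix j assume "j \<in> {..<n}"
    then have "j < n + 2" "j + 1 < n + 2" "j + 2 < n + 2"
      by simp_all
    then show "window_weight u ((xs @ take 2 xs) ! j) ((xs @ take 2 xs) ! (j + 1)) ((xs @ take 2 xs) ! (j + 2)) =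
        window_weight u (c (j mod n + 1)) (c ((j + 1) mod n + 1)) (c ((j + 2) mod n + 1))"
      by (simp only: nth)
  qed
  also have "\<dots> = (\<Prod>j<n. window_weight u (c (Suc j)) (c (Suc j mod n + 1))
      (c ((Suc j mod n + 1) mod n + 1)))"
    by (intro prod.cong) (simp_all add: mod_Suc_eq)
  also have "\<dots> = (\<Prod>i\<in>{1..n}. window_weight u (c i) (c (i mod n + 1)) (c ((i mod n + 1) mod n + 1)))"
    by (rule prod.reindex_bij_witness[of _ "\<lambda>i. i - 1" Suc]) auto
  finally show ?thesis
    by (simp only: integrated_weight_eq_prod)
qed

lemma sum_integrated_eq_sum_words:
  assumes "n \<ge> 2"
  shows "(\<Sum>c\<in>IC (cycle n). u ^ mix (cycle n) c) =
    (\<Sum>xs | length xs = n. word_weight u (xs @ take 2 xs))"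
proof -
  have fin: "finite (colorings (cycle n))"
  proof -
    have "(UNIV :: color set) = {Black, White}"
      using color.exhaust by auto
    then have "finite (UNIV :: color set)"
      by (metis finite.emptyI finite.insertI)
    then show ?thesis by (simp add: colorings_def finite_PiE)
  qed
  have "(\<Sum>c\<in>IC (cycle n). u ^ mix (cycle n) c) =
      (\<Sum>c\<in>colorings (cycle n). if integrated (cycle n) c then u ^ mix (cycle n) c else 0)"
    unfolding IC_def by (rule sum.inter_filter[OF fin])
  also have "\<dots> = (\<Sum>xs | length xs = n. word_weight u (xs @ take 2 xs))"
  proof (rule sum.reindex_bij_witness[of _ "\<lambda>xs. \<lambda>k\<in>{1..n}. xs ! (k - 1)" "\<lambda>c. map c [1..<n + 1]"])
    fix c assume "c \<in> colorings (cycle n)"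
    then show "(\<lambda>k\<in>{1..n}. map c [1..<n + 1] ! (k - 1)) = c"
      by (auto simp: colorings_def PiE_def extensional_def restrict_def fun_eq_iff simp del: upt_Suc)
    show "word_weight u (map c [1..<n + 1] @ take 2 (map c [1..<n + 1])) =
        (if integrated (cycle n) c then u ^ mix (cycle n) c else 0)"
      by (rule integrated_weight_eq_word_weight[symmetric]) (use assms in \<open>simp_all del: upt_Suc\<close>)
  next
    fix xs :: "color list" assume "xs \<in> {xs. length xs = n}"
    then show "map (\<lambda>k\<in>{1..n}. xs ! (k - 1)) [1..<n + 1] = xs"
      by (auto intro!: nth_equalityI simp del: upt_Suc)
  qed (auto simp: colorings_def)
  finally show ?thesis .
qed

section \<open>The transfer recurrence\<close>

lemma sum_words_Suc:
  fixes f :: "color list \<Rightarrow> 'a::comm_monoid_add"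
  shows "(\<Sum>xs | length xs = Suc m. f xs) =
    (\<Sum>xs | length xs = m. f (Black # xs)) + (\<Sum>xs | length xs = m. f (White # xs))"
proof -
  have fin: "finite {xs :: color list. length xs = m}"
  proof -
    have "set xs \<subseteq> {Black, White}" for xs
      using color.exhaust by auto
    then show ?thesis
      using finite_lists_length_eq[of "{Black, White}" m] by simp
  qed
  have "{xs. length xs = Suc m} = (Cons Black) ` {xs. length xs = m} \<union> (Cons White) ` {xs. length xs = m}"
    (is "_ = ?B \<union> ?W")
  proof (intro equalityI subsetI)
    fix xs :: "color list" assume "xs \<in> {xs. length xs = Suc m}"
    then obtain x ys where "xs = x # ys" "length ys = m"
      by (auto simp: length_Suc_conv)
    then show "xs \<in> ?B \<union> ?W" by (cases x) auto
  qed auto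
  then have "(\<Sum>xs | length xs = Suc m. f xs) = sum f ?B + sum f ?W"
    using fin by (simp only:) (rule sum.union_disjoint, auto)
  then show ?thesis
    by (simp add: sum.reindex)
qed

definition bridge_sum :: "'a::comm_ring_1 \<Rightarrow> nat \<Rightarrow> color \<Rightarrow> color \<Rightarrow> color \<Rightarrow> color \<Rightarrow> 'a" where
  "bridge_sum u m x y x' y' = (\<Sum>zs | length zs = m. word_weight u (x # y # zs @ [x', y']))"

lemma bridge_sum_0:
  "bridge_sum u 0 x y x' y' = window_weight u x y x' * window_weight u y x' y'"
  by (simp add: bridge_sum_def)

lemma bridge_sum_Suc:
  "bridge_sum u (Suc m) x y x' y' =
    window_weight u x y Black * bridge_sum u m y Black x' y' +
    window_weight u x y White * bridge_sum u m y White x' y'"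
  by (simp add: bridge_sum_def sum_words_Suc sum_distrib_left)

text \<open>
  Removing one block gives a recurrence of order 2 with characteristic series
  \<open>1 - (u z + u z\<^sup>2)\<close>, but it interchanges the colors at the start of the word while the end stays
  fixed, so it does not apply to closed words. Applying it twice restores the starting pair; four
  steps of the transfer matrix are enough for that, whichever pair comes first.
\<close>

lemma bridge_sum_recurrence:
  "bridge_sum u (m + 4) x y x' y' =
    u\<^sup>2 * bridge_sum u (m + 2) x y x' y' + 2 * u\<^sup>2 * bridge_sum u (m + 1) x y x' y'
      + u\<^sup>2 * bridge_sum u m x y x' y'"
  by (cases x; cases y)
    (simp_all add: bridge_sum_Suc window_weight_def eval_nat_numeral algebra_simps)

text \<open>
  The index counts the vertices other than the two at which the cycle is cut: \<open>closed_sum u m\<close>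
  belongs to the cycle of order \<open>m + 2\<close>.
\<close>

definition closed_sum :: "'a::comm_ring_1 \<Rightarrow> nat \<Rightarrow> 'a" where
  "closed_sum u m = (\<Sum>xs | length xs = m + 2. word_weight u (xs @ take 2 xs))"

lemma closed_sum_eq_bridge_sums:
  "closed_sum u m =
    bridge_sum u m Black Black Black Black + bridge_sum u m Black White Black White +
    bridge_sum u m White Black White Black + bridge_sum u m White White White White"
  by (simp add: closed_sum_def bridge_sum_def sum_words_Suc add.assoc)

lemma closed_sum_recurrence:
  "closed_sum u (m + 4) =
    u\<^sup>2 * closed_sum u (m + 2) + 2 * u\<^sup>2 * closed_sum u (m + 1) + u\<^sup>2 * closed_sum u m"
  unfolding closed_sum_eq_bridge_sums bridge_sum_recurrence by (simp add: algebra_simps)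

text \<open>
  The first value is the smallest cycle with its two parallel edges, both of them balanced. The
  recurrence starts at \<open>m = 4\<close>, so four values determine all others.
\<close>

lemma closed_sum_initial:
  "closed_sum u 0 = 2 * u\<^sup>2"
  "closed_sum u 1 = 6 * u\<^sup>2"
  "closed_sum u 2 = 4 * u\<^sup>2 + 2 * u ^ 4"
  "closed_sum u 3 = 10 * u ^ 4"
  by (simp_all add: closed_sum_eq_bridge_sums bridge_sum_0 bridge_sum_Suc window_weight_def
      eval_nat_numeral algebra_simps)

section \<open>The generating function\<close>

lemma nth_integrated_cycles_gf:
  "fps_nth integrated_cycles_gf n = (if n \<ge> 2 then closed_sum [:0, 1:] (n - 2) else 0)"
proof (cases "n \<ge> 2")
  case True
  then have "n - 2 + 2 = n" by simp
  with True show ?thesis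
    by (simp only: integrated_cycles_gf_def fps_nth_Abs_fps sum_integrated_eq_sum_words
        closed_sum_def if_True)
qed (simp add: integrated_cycles_gf_def)

theorem theorem13:
  shows "integrated_cycles_gf =
    fps_quot
      (2 * var_u ^ 2 * var_z ^ 2 + 6 * var_u ^ 2 * var_z ^ 3 + 4 * var_u ^ 2 * var_z ^ 4)
      (1 - var_u ^ 2 * var_z ^ 2 - 2 * var_u ^ 2 * var_z ^ 3 - var_u ^ 2 * var_z ^ 4)"
    (is "_ = fps_quot ?num ?den")
proof -
  define u :: "int poly" where "u = [:0, 1:]"
  let ?h = integrated_cycles_gf
  have num: "?num = fps_const (2 * u\<^sup>2) * fps_X ^ 2 + fps_const (6 * u\<^sup>2) * fps_X ^ 3
      + fps_const (4 * u\<^sup>2) * fps_X ^ 4"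
    unfolding u_def[symmetric] by (simp add: fps_const_power numeral_fps_const flip: fps_const_mult)
  have den: "?den = 1 - fps_const (u\<^sup>2) * fps_X ^ 2 - fps_const (2 * u\<^sup>2) * fps_X ^ 3
      - fps_const (u\<^sup>2) * fps_X ^ 4"
    unfolding u_def[symmetric] by (simp add: fps_const_power numeral_fps_const flip: fps_const_mult)
  have "?num = ?h * ?den"
  proof (rule fps_ext)
    fix n
    have num_nth: "fps_nth ?num n = (if n = 2 then 2 * u\<^sup>2 else 0)
        + (if n = 3 then 6 * u\<^sup>2 else 0) + (if n = 4 then 4 * u\<^sup>2 else 0)"
      unfolding num by (simp add: fps_X_power_nth)
    have mult: "?h * ?den = ?h - fps_const (u\<^sup>2) * (?h * fps_X ^ 2)
        - fps_const (2 * u\<^sup>2) * (?h * fps_X ^ 3) - fps_const (u\<^sup>2) * (?h * fps_X ^ 4)"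
      unfolding den by (simp add: algebra_simps)
    have coeff: "fps_nth (?h * ?den) n = fps_nth ?h n
        - u\<^sup>2 * (if n < 2 then 0 else fps_nth ?h (n - 2))
        - 2 * u\<^sup>2 * (if n < 3 then 0 else fps_nth ?h (n - 3))
        - u\<^sup>2 * (if n < 4 then 0 else fps_nth ?h (n - 4))"
      unfolding mult by (simp add: fps_X_power_mult_right_nth)
    \<comment> \<open>Order 6 is the first one at which all terms of the recurrence are sums over closed words.\<close>
    consider "n = 0" | "n = 1" | "n = 2" | "n = 3" | "n = 4" | "n = 5" | m where "n = m + 6"
    proof -
      have "n \<in> {0,1,2,3,4,5} \<or> n = (n - 6) + 6" by auto
      then show ?thesis using that by blast
    qed
    then have "(if n = 2 then 2 * u\<^sup>2 else 0) + (if n = 3 then 6 * u\<^sup>2 else 0)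
        + (if n = 4 then 4 * u\<^sup>2 else 0) = fps_nth ?h n
        - u\<^sup>2 * (if n < 2 then 0 else fps_nth ?h (n - 2))
        - 2 * u\<^sup>2 * (if n < 3 then 0 else fps_nth ?h (n - 3))
        - u\<^sup>2 * (if n < 4 then 0 else fps_nth ?h (n - 4))"
    proof cases
      case 7
      then show ?thesis
        using closed_sum_recurrence[of u m]
        by (simp add: nth_integrated_cycles_gf add.commute[of 4] flip: u_def)
    qed (simp_all add: nth_integrated_cycles_gf closed_sum_initial
        closed_sum_initial[unfolded One_nat_def] algebra_simps flip: u_def power_add)
    then show "fps_nth ?num n = fps_nth (?h * ?den) n"
      unfolding coeff num_nth .
  qed
  moreover have "fps_nth ?den 0 = 1"
    unfolding den by simp
  ultimately show ?thesis
    by (metis fps_quot_eq_iff)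
qed

end
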